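(* The normal Hamiltonian vector field $\vec H$, $H=\frac12(h_1^2+h_2^2)$, on $T^*G$ has an algebra $$I=\mathrm{span}(H,g_1,\dots,g_8,h_0)$$ of 10 independent integrals, with the nonzero brackets \begin{gather*} \{h_0,g_4\}=g_5,\qquad \{h_0,g_5\}=-g_4,\\ \{h_0,g_6\}=2g_7,\qquad \{h_0,g_7\}=g_8-g_6,\qquad \{h_0,g_8\}=-2g_7, \end{gather*} and an Abelian algebra $$A=\mathrm{span}(H,g_3,\dots,g_8)$$ of 7 independent integrals.
   Context: On $\mathbb{R}^8$ with coordinates $(x_1,\dots,x_8)$ consider the vector fields \begin{align*} X_1 &= \frac{\partial}{\partial x_1} - \frac{x_2}{2}\frac{\partial}{\partial x_3} - \frac{x_1^2+x_2^2}{2}\frac{\partial}{\partial x_5} - \frac{x_1x_2^2}{4}\frac{\partial}{\partial x_7} - \frac{x_2^3}{6}\frac{\partial}{\partial x_8},\\ X_2 &= \frac{\partial}{\partial x_2} + \frac{x_1}{2}\frac{\partial}{\partial x_3} + \frac{x_1^2+x_2^2}{2}\frac{\partial}{\partial x_4} + \frac{x_1^3}{6}\frac{\partial}{\partial x_6} + \frac{x_1^2x_2}{4}\frac{\partial}{\partial x_7}, \end{align*} and $X_3=[X_1,X_2]$, $X_4=[X_1,X_3]$, $X_5=[X_2,X_3]$, $X_6=[X_1,X_4]=\frac{\partial}{\partial x_6}$, $X_7=[X_1,X_5]=[X_2,X_4]=\frac{\partial}{\partial x_7}$, $X_8=[X_2,X_5]=\frac{\partial}{\partial x_8}$ (all other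 brackets $[X_i,X_j]$ with $i<j$ are zero). $G=\mathbb{R}^8$ is the connected simply connected Lie group with identity element $\mathrm{Id}=0$ for which $X_1,\dots,X_8$ form a left-invariant frame. $Y_1,\dots,Y_8$ is the right-invariant frame on $G$ with $Y_j(\mathrm{Id})=-X_j(\mathrm{Id})$; in particular $Y_i=-\frac{\partial}{\partial x_i}$ for $i=3,\dots,8$. Further, $$X_0 = x_2\frac{\partial}{\partial x_1} - x_1\frac{\partial}{\partial x_2} + x_5\frac{\partial}{\partial x_4} - x_4\frac{\partial}{\partial x_5} + P\frac{\partial}{\partial x_6} + Q\frac{\partial}{\partial x_7} + R\frac{\partial}{\partial x_8},$$ $$P = -\frac{x_1^4}{24}+\frac{x_1^2x_2^2}{8}+x_7,\quad Q = \frac{x_1x_2^3}{12}+\frac{x_1^3x_2}{12}-2x_6+2x_8,\quad R = \frac{x_1^2x_2^2}{8}-\frac{x_2^4}{24}-x_7.$$ On $T^*G$ define the linear-on-fibers Hamiltonians $h_i(\lambda)=\langle\lambda,X_i\rangle$ ($i=0,1,\dots,8$) and $g_i(\lambda)=\langle\lambda,Y_i\rangle$ ($i=1,\dots,8$). $\{\cdot,\cdot\}$ is the canonical Poisson bracket on $T^*G$ with the sign convention $\{h_X,h_Y\}=h_{[X,Y]}$, where $h_X(\lambda)=\langle\lambda,X\rangle$ and $[X,Y]f=X(Yf)-Y(Xf)$; the Hamiltonian vector field $\vec H$ acts by $\vec Hf=\{H,f\}$. An integral of $\vec H$ is a smooth function $f$ on $T^*G$ with $\{H,f\}=0$. $I$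 and $A$ are real linear spans, regarded as algebras under the Poisson bracket; "the nonzero brackets" of $I$ means that all brackets of the listed spanning functions other than those displayed (and those following from them by skew-symmetry) are zero. Independent means functionally independent.
   Formalization: The list of nonzero brackets of I is incomplete as stated; also nonzero are {h0,g1}=g2, {h0,g2}=-g1, {g1,g2}=g3, {g1,g3}=g4, {g2,g3}=g5, {g1,g4}=g6, {g1,g5}={g2,g4}=g7, {g2,g5}=g8. These are added, and all remaining brackets are shown to vanish. *)

theory Defs
  imports "HOL-Analysis.Analysis" "HOL-Algebra.Group"
begin

(* Smooth = C^k for every k, through iterated directional derivatives; for maps between
   finite-dimensional spaces this is the usual notion. *)

primrec C_k :: "nat \<Rightarrow> ('a::real_normed_vector \<Rightarrow> 'b::real_normed_vector) \<Rightarrow> bool" where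
  "C_k 0 f \<longleftrightarrow> continuous_on UNIV f"
| "C_k (Suc k) f \<longleftrightarrow>
     (\<forall>x. f differentiable (at x)) \<and> (\<forall>v. C_k k (\<lambda>x. frechet_derivative f (at x) v))"

definition smooth :: "('a::real_normed_vector \<Rightarrow> 'b::real_normed_vector) \<Rightarrow> bool" where
  "smooth f \<longleftrightarrow> (\<forall>k. C_k k f)"


type_synonym 'n vfield = "real ^ 'n \<Rightarrow> real ^ 'n"

definition vf_apply :: "'n::finite vfield \<Rightarrow> (real ^ 'n \<Rightarrow> real) \<Rightarrow> real ^ 'n \<Rightarrow> real" where
  "vf_apply V f = (\<lambda>x. frechet_derivative f (at x) (V x))"

(* [V,W] f = V (W f) - W (V f), evaluated on the coordinate functions f = x_i. *)
definition lie_bracket :: "'n::finite vfield \<Rightarrow> 'n vfield \<Rightarrow> 'n vfield" where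
  "lie_bracket V W =
     (\<lambda>x. \<chi> i. vf_apply V (\<lambda>y. W y $ i) x - vf_apply W (\<lambda>y. V y $ i) x)"


definition lie_group_on :: "(real ^ 'n::finite) monoid \<Rightarrow> bool" where
  "lie_group_on G \<longleftrightarrow> group G \<and> carrier G = UNIV \<and>
     smooth (\<lambda>(x, y). x \<otimes>\<^bsub>G\<^esub> y) \<and> smooth (\<lambda>x. inv\<^bsub>G\<^esub> x)"

definition left_invariant :: "(real ^ 'n::finite) monoid \<Rightarrow> 'n vfield \<Rightarrow> bool" where
  "left_invariant G V \<longleftrightarrow>
     (\<forall>a x. frechet_derivative (\<lambda>y. a \<otimes>\<^bsub>G\<^esub> y) (at x) (V x) = V (a \<otimes>\<^bsub>G\<^esub> x))"

definition right_invariant :: "(real ^ 'n::finite) monoid \<Rightarrow> 'n vfield \<Rightarrow> bool" where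
  "right_invariant G V \<longleftrightarrow>
     (\<forall>a x. frechet_derivative (\<lambda>y. y \<otimes>\<^bsub>G\<^esub> a) (at x) (V x) = V (x \<otimes>\<^bsub>G\<^esub> a))"


(* The cotangent bundle of R^n in canonical coordinates: a covector is a pair (x, p), where p
   holds the components with respect to dx_1, ..., dx_n. *)
type_synonym 'n cotangent = "(real ^ 'n) \<times> (real ^ 'n)"

definition ham :: "'n::finite vfield \<Rightarrow> 'n cotangent \<Rightarrow> real" where
  "ham V = (\<lambda>(x, p). p \<bullet> V x)"

definition d_x :: "'n::finite \<Rightarrow> ('n cotangent \<Rightarrow> real) \<Rightarrow> 'n cotangent \<Rightarrow> real" where
  "d_x i f z = frechet_derivative f (at z) (axis i 1, 0)"

definition d_p :: "'n::finite \<Rightarrow> ('n cotangent \<Rightarrow> real) \<Rightarrow> 'n cotangent \<Rightarrow> real" where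
  "d_p i f z = frechet_derivative f (at z) (0, axis i 1)"

(* With this sign, poisson (ham V) (ham W) = ham (lie_bracket V W) for smooth V, W. *)
definition poisson ::
    "('n::finite cotangent \<Rightarrow> real) \<Rightarrow> ('n cotangent \<Rightarrow> real) \<Rightarrow> 'n cotangent \<Rightarrow> real" where
  "poisson f g = (\<lambda>z. \<Sum>i\<in>UNIV. d_p i f z * d_x i g z - d_x i f z * d_p i g z)"

definition is_integral :: "('n::finite cotangent \<Rightarrow> real) \<Rightarrow> ('n cotangent \<Rightarrow> real) \<Rightarrow> bool" where
  "is_integral H f \<longleftrightarrow> smooth f \<and> poisson H f = (\<lambda>_. 0)"

definition fun_span :: "('a \<Rightarrow> real) list \<Rightarrow> ('a \<Rightarrow> real) set" where
  "fun_span fs = {f. \<exists>c. f = (\<lambda>z. \<Sum>k<length fs. c k * (fs ! k) z)}"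

definition poisson_closed :: "('n::finite cotangent \<Rightarrow> real) set \<Rightarrow> bool" where
  "poisson_closed S \<longleftrightarrow> (\<forall>f\<in>S. \<forall>g\<in>S. poisson f g \<in> S)"

definition poisson_abelian :: "('n::finite cotangent \<Rightarrow> real) set \<Rightarrow> bool" where
  "poisson_abelian S \<longleftrightarrow> (\<forall>f\<in>S. \<forall>g\<in>S. poisson f g = (\<lambda>_. 0))"

(* The differentials are linearly independent at every point of an open dense set. *)
definition functionally_independent :: "('a::euclidean_space \<Rightarrow> real) list \<Rightarrow> bool" where
  "functionally_independent fs \<longleftrightarrow>
     (\<exists>U. open U \<and> closure U = UNIV \<and>
       (\<forall>z\<in>U. \<forall>c :: nat \<Rightarrow> real.
          (\<forall>v. (\<Sum>k<length fs. c k * frechet_derivative (fs ! k) (at z) v) = 0) \<longrightarrow>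
          (\<forall>k<length fs. c k = 0)))"


(* The index type 8 is the integers modulo 8, so 1, ..., 8 are its eight distinct elements
   (8 = 0) and x $ 1, ..., x $ 8 are the coordinates x_1, ..., x_8. *)

abbreviation Dx :: "8 \<Rightarrow> real ^ 8" where
  "Dx i \<equiv> axis i 1"

definition X1 :: "8 vfield" where
  "X1 x = Dx 1 - (x$2 / 2) *\<^sub>R Dx 3 - (((x$1)\<^sup>2 + (x$2)\<^sup>2) / 2) *\<^sub>R Dx 5
     - (x$1 * (x$2)\<^sup>2 / 4) *\<^sub>R Dx 7 - ((x$2)^3 / 6) *\<^sub>R Dx 8"

definition X2 :: "8 vfield" where
  "X2 x = Dx 2 + (x$1 / 2) *\<^sub>R Dx 3 + (((x$1)\<^sup>2 + (x$2)\<^sup>2) / 2) *\<^sub>R Dx 4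
     + ((x$1)^3 / 6) *\<^sub>R Dx 6 + ((x$1)\<^sup>2 * x$2 / 4) *\<^sub>R Dx 7"

definition "X3 = lie_bracket X1 X2"
definition "X4 = lie_bracket X1 X3"
definition "X5 = lie_bracket X2 X3"
definition "X6 = lie_bracket X1 X4"
definition "X7 = lie_bracket X1 X5"
definition "X8 = lie_bracket X2 X5"

definition X0 :: "8 vfield" where
  "X0 x =
     (let P = - ((x$1)^4 / 24) + (x$1)\<^sup>2 * (x$2)\<^sup>2 / 8 + x$7;
          Q = x$1 * (x$2)^3 / 12 + (x$1)^3 * x$2 / 12 - 2 * x$6 + 2 * x$8;
          R = (x$1)\<^sup>2 * (x$2)\<^sup>2 / 8 - (x$2)^4 / 24 - x$7
      in x$2 *\<^sub>R Dx 1 - x$1 *\<^sub>R Dx 2 + x$5 *\<^sub>R Dx 4 - x$4 *\<^sub>R Dx 5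
         + P *\<^sub>R Dx 6 + Q *\<^sub>R Dx 7 + R *\<^sub>R Dx 8)"

definition X :: "nat \<Rightarrow> 8 vfield" where
  "X i = [X0, X1, X2, X3, X4, X5, X6, X7, X8] ! i"

end

theory Submission
  imports Defs
begin

text \<open>Lie brackets of explicit vector fields carry the whole proof, because the Poisson bracket of two
  Hamiltonians that are linear on the fibres is the Hamiltonian of the Lie bracket
  (\<open>poisson_ham\<close>). What has to be found first is the right-invariant frame in coordinates.

  The group law is not given by a formula, but left invariance of \<open>X 1, \<dots>, X 8\<close> determines it. For a fixed
  \<open>a\<close>, the derivatives of the coordinates of \<open>x \<mapsto> a \<otimes> x\<close> along this frame are
  prescribed in terms of \<open>a \<otimes> x\<close>. The coefficients of the frame depend only on the first two
  coordinates, and in these two directions they are constant; so the first two coordinates of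
  \<open>a \<otimes> x\<close> are found first, and the other six follow, since a function with given derivatives along
  a frame is determined by its value at the origin (\<open>mult_eq_group_mult\<close>). The field \<open>Y j\<close> is
  the image of \<open>- X j 0\<close> under the derivatives of the right translations
  (\<open>right_invariant_eq_right_field\<close>).

  Left-invariant and right-invariant fields commute, so the \<open>g j\<close> commute with \<open>h 1\<close> and
  \<open>h 2\<close> and hence with \<open>H\<close>. The field \<open>X0\<close> rotates the pair \<open>X 1\<close>, \<open>X 2\<close>,
  namely \<open>[X0, X 1] = X 2\<close> and \<open>[X0, X 2] = - X 1\<close>, so \<open>h 0\<close> commutes with
  \<open>(h 1)\<^sup>2 + (h 2)\<^sup>2\<close>. The remaining brackets are those of \<open>X0\<close> and the right-invariant
  fields.

  For independence, a linear relation between the differentials of \<open>H, g 1, \<dots>, g 8, h 0\<close> at a point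
  is applied to the Hamiltonian vectors of \<open>h 3\<close> and \<open>h 1\<close>, which annihilate the
  differentials of all \<open>g j\<close>. As \<open>{h 3, h 0} = 0\<close>, \<open>{h 3, H} = - (h 1 h 4 + h 2 h 5)\<close> and
  \<open>{h 1, h 0} = - h 2\<close>, the coefficients of \<open>H\<close> and \<open>h 0\<close> vanish wherever
  \<open>h 2 (h 1 h 4 + h 2 h 5)\<close> does not; the vertical part of the relation then says that a combination
  of the right-invariant frame vanishes (\<open>integrals_independent_at\<close>). That regular set is dense
  because its defining function is a monic cubic polynomial on suitable lines in the fibres
  (\<open>regular_factor_dense\<close>).\<close>

section \<open>Smooth functions\<close>

lemma frechet_derivative_eqI: "(f has_derivative f') (at x) \<Longrightarrow> frechet_derivative f (at x) = f'"
  using frechet_derivative_at by metis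

lemma C_k_const: "C_k k (\<lambda>_. c)"
proof (induction k arbitrary: c)
  case (Suc k)
  have "frechet_derivative (\<lambda>_. c) (at x) = (\<lambda>_. 0)" for x
    by (rule frechet_derivative_eqI) simp
  then show ?case using Suc by simp
qed simp

lemma C_k_bounded_linear: "bounded_linear f \<Longrightarrow> C_k k f"
proof (cases k)
  case 0
  assume "bounded_linear f"
  then show ?thesis
    using 0 by (simp add: linear_continuous_on)
next
  case (Suc m)
  assume "bounded_linear f"
  then have d: "(f has_derivative f) (at x)" for x
    by (rule bounded_linear_imp_has_derivative)
  then have "frechet_derivative f (at x) = f" for x
    by (rule frechet_derivative_eqI)
  then show ?thesis
    using d Suc by (auto simp: C_k_const differentiable_def)
qed

text \<open>The product rule brings back the undifferentiated factors, so the induction for products needs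
  that the classes \<open>C_k\<close> decrease in \<open>k\<close>.\<close>

lemma C_k_Suc_imp_C_k: "C_k (Suc k) f \<Longrightarrow> C_k k f"
proof (induction k arbitrary: f)
  case 0
  then have "f differentiable_on UNIV"
    by (simp add: differentiable_on_def)
  then show ?case
    by (simp add: differentiable_imp_continuous_on)
next
  case (Suc k)
  then show ?case by (metis C_k.simps(2))
qed

lemma C_k_add: "C_k k f \<Longrightarrow> C_k k g \<Longrightarrow> C_k k (\<lambda>x. f x + g x)"
proof (induction k arbitrary: f g)
  case 0
  then show ?case by (simp add: continuous_on_add)
next
  case (Suc k)
  have "frechet_derivative (\<lambda>x. f x + g x) (at x) =
      (\<lambda>v. frechet_derivative f (at x) v + frechet_derivative g (at x) v)" for x
    using Suc.prems
    by (intro frechet_derivative_eqI has_derivative_add) (auto simp: frechet_derivative_works[symmetric])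
  then show ?case
    using Suc by (auto intro: differentiable_add)
qed

lemma C_k_mult:
  fixes f g :: "'a::real_normed_vector \<Rightarrow> real"
  shows "C_k k f \<Longrightarrow> C_k k g \<Longrightarrow> C_k k (\<lambda>x. f x * g x)"
proof (induction k arbitrary: f g)
  case 0
  then show ?case by (simp add: continuous_on_mult)
next
  case (Suc k)
  have "frechet_derivative (\<lambda>x. f x * g x) (at x) =
      (\<lambda>v. f x * frechet_derivative g (at x) v + frechet_derivative f (at x) v * g x)" for x
    using Suc.prems
    by (intro frechet_derivative_eqI has_derivative_mult) (auto simp: frechet_derivative_works[symmetric])
  moreover have "C_k k f" "C_k k g"
    using Suc.prems by (auto dest!: C_k_Suc_imp_C_k simp del: C_k.simps)
  ultimately show ?case
    using Suc by (auto intro!: C_k_add)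
qed

text \<open>Composition with a linear map suffices here: the functions on the cotangent bundle are
  assembled from functions of \<open>x\<close> alone, pulled back along \<^const>\<open>fst\<close>, and from the coordinates \<open>p\<close>.\<close>

lemma C_k_compose_bounded_linear:
  assumes "bounded_linear L"
  shows "C_k k f \<Longrightarrow> C_k k (\<lambda>x. f (L x))"
proof (induction k arbitrary: f)
  case 0
  have "continuous_on UNIV (f \<circ> L)"
    using 0 assms by (intro continuous_on_compose)
      (auto simp: linear_continuous_on intro: continuous_on_subset)
  then show ?case by (simp add: o_def)
next
  case (Suc k)
  have d: "((\<lambda>x. f (L x)) has_derivative (\<lambda>v. frechet_derivative f (at (L x)) (L v))) (at x)" for x
  proof -
    have "(L has_derivative L) (at x)"
      using assms by (rule bounded_linear_imp_has_derivative)
    moreover have "(f has_derivative frechet_derivative f (at (L x))) (at (L x))"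
      using Suc.prems by (simp add: frechet_derivative_works[symmetric])
    ultimately show ?thesis
      by (rule has_derivative_compose)
  qed
  then have "frechet_derivative (\<lambda>x. f (L x)) (at x) = (\<lambda>v. frechet_derivative f (at (L x)) (L v))" for x
    by (rule frechet_derivative_eqI)
  moreover have "C_k k (\<lambda>x. frechet_derivative f (at (L x)) (L v))" for v
    using Suc.prems by (intro Suc.IH[of "\<lambda>y. frechet_derivative f (at y) (L v)"]) simp
  ultimately show ?case
    using d by (auto simp: differentiable_def)
qed

lemma smooth_const [simp]: "smooth (\<lambda>_. c)"
  by (simp add: smooth_def C_k_const)

lemma smooth_bounded_linear: "bounded_linear f \<Longrightarrow> smooth f"
  by (simp add: smooth_def C_k_bounded_linear)

lemma smooth_add [simp]: "smooth f \<Longrightarrow> smooth g \<Longrightarrow> smooth (\<lambda>x. f x + g x)"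
  by (simp add: smooth_def C_k_add)

lemma smooth_mult [simp]:
  fixes f g :: "'a::real_normed_vector \<Rightarrow> real"
  shows "smooth f \<Longrightarrow> smooth g \<Longrightarrow> smooth (\<lambda>x. f x * g x)"
  by (simp add: smooth_def C_k_mult)

lemma smooth_uminus [simp]: "smooth f \<Longrightarrow> smooth (\<lambda>x. - f x :: real)"
  using smooth_mult[OF smooth_const[of "-1"], of f] by simp

lemma smooth_diff [simp]: "smooth f \<Longrightarrow> smooth g \<Longrightarrow> smooth (\<lambda>x. f x - g x :: real)"
  using smooth_add[of f "\<lambda>x. - g x"] by simp

lemma smooth_divide_const [simp]: "smooth f \<Longrightarrow> smooth (\<lambda>x. f x / c :: real)"
  using smooth_mult[of f "\<lambda>_. inverse c"] by (simp add: divide_inverse)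

lemma smooth_power [simp]: "smooth f \<Longrightarrow> smooth (\<lambda>x. f x ^ n :: real)"
  by (induction n) simp_all

lemma smooth_sum: "(\<And>i. i \<in> S \<Longrightarrow> smooth (f i)) \<Longrightarrow> smooth (\<lambda>x. \<Sum>i\<in>S. f i x)"
  by (induction S rule: infinite_finite_induct) simp_all

lemma smooth_component [simp]: "smooth (\<lambda>x::real^'n. x $ i)"
  by (rule smooth_bounded_linear) (rule bounded_linear_vec_nth)

lemma smooth_imp_differentiable: "smooth f \<Longrightarrow> f differentiable (at x)"
  by (metis C_k.simps(2) smooth_def)

section \<open>Vector fields as derivations\<close>

text \<open>The rules below turn \<^const>\<open>vf_apply\<close> into a symbolic derivation: the simplifier then
  evaluates Lie brackets of polynomial vector fields, given their components.\<close>

lemma differentiable_component [simp]: "(\<lambda>y::real^'n. y $ i) differentiable (at x)"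
  by (simp add: smooth_imp_differentiable)

lemma differentiable_divide_const [simp]:
  "f differentiable (at x) \<Longrightarrow> (\<lambda>y. f y / c :: real) differentiable (at x)"
  using differentiable_mult[of f x UNIV "\<lambda>_. inverse c"] by (simp add: divide_inverse)

declare differentiable_add [simp] differentiable_diff [simp] differentiable_minus [simp]
  differentiable_mult [simp] differentiable_power [simp]

lemma vf_apply_eqI: "(f has_derivative f') (at x) \<Longrightarrow> vf_apply V f x = f' (V x)"
  by (simp add: vf_apply_def frechet_derivative_eqI)

lemma vf_apply_const [simp]: "vf_apply V (\<lambda>_. c) x = 0"
  by (subst vf_apply_eqI[where f' = "\<lambda>_. 0"]) simp_all

lemma vf_apply_component [simp]: "vf_apply V (\<lambda>y. y $ i) x = V x $ i"
  by (rule vf_apply_eqI) (intro bounded_linear_imp_has_derivative bounded_linear_vec_nth)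

lemma vf_apply_add [simp]:
  "f differentiable (at x) \<Longrightarrow> g differentiable (at x) \<Longrightarrow>
    vf_apply V (\<lambda>y. f y + g y) x = vf_apply V f x + vf_apply V g x"
  unfolding vf_apply_def[of V f] vf_apply_def[of V g]
  by (rule vf_apply_eqI) (auto intro: has_derivative_add simp: frechet_derivative_works)

lemma vf_apply_diff [simp]:
  "f differentiable (at x) \<Longrightarrow> g differentiable (at x) \<Longrightarrow>
    vf_apply V (\<lambda>y. f y - g y) x = vf_apply V f x - vf_apply V g x"
  unfolding vf_apply_def[of V f] vf_apply_def[of V g]
  by (rule vf_apply_eqI) (auto intro: has_derivative_diff simp: frechet_derivative_works)

lemma vf_apply_uminus [simp]:
  "f differentiable (at x) \<Longrightarrow> vf_apply V (\<lambda>y. - f y) x = - vf_apply V f x"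
  unfolding vf_apply_def[of V f]
  by (rule vf_apply_eqI) (auto intro: has_derivative_minus simp: frechet_derivative_works)

lemma vf_apply_mult [simp]:
  "f differentiable (at x) \<Longrightarrow> g differentiable (at x) \<Longrightarrow>
    vf_apply V (\<lambda>y. f y * g y) x = f x * vf_apply V g x + vf_apply V f x * g x"
  unfolding vf_apply_def[of V f] vf_apply_def[of V g]
  by (rule vf_apply_eqI) (auto intro: has_derivative_mult simp: frechet_derivative_works)

lemma vf_apply_divide_const [simp]:
  "f differentiable (at x) \<Longrightarrow> vf_apply V (\<lambda>y. f y / c) x = vf_apply V f x / c"
  using vf_apply_mult[of f x "\<lambda>_. inverse c" V] by (simp add: divide_inverse)

lemma vf_apply_power [simp]:
  "f differentiable (at x) \<Longrightarrow> vf_apply V (\<lambda>y. f y ^ n) x = of_nat n * f x ^ (n - 1) * vf_apply V f x"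
  unfolding vf_apply_def[of V f]
  by (rule vf_apply_eqI)
    (auto intro!: has_derivative_eq_rhs[OF has_derivative_power] simp: frechet_derivative_works algebra_simps)

lemma lie_bracket_component:
  "lie_bracket V W x $ k = vf_apply V (\<lambda>y. W y $ k) x - vf_apply W (\<lambda>y. V y $ k) x"
  by (simp add: lie_bracket_def)

lemma lie_bracket_const: "lie_bracket (\<lambda>_. a) (\<lambda>_. b) = (\<lambda>_. 0)"
  by (simp add: fun_eq_iff vec_eq_iff lie_bracket_component)

lemma lie_bracket_antisym: "lie_bracket W V = (\<lambda>x. - lie_bracket V W x)"
  by (auto simp: lie_bracket_def vec_eq_iff)

section \<open>The canonical Poisson bracket\<close>

text \<open>The vector \<open>(\<partial>f/\<partial>p, - \<partial>f/\<partial>x)\<close>.\<close>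

text \<open>The bracket is the derivative of its second argument along this vector, which reduces its
  linearity to that of derivatives. It is also the vector to which relations between differentials
  are applied in the proof of independence.\<close>

definition ham_vector :: "('n::finite cotangent \<Rightarrow> real) \<Rightarrow> 'n cotangent \<Rightarrow> 'n cotangent" where
  "ham_vector f z = (\<Sum>i\<in>UNIV. d_p i f z *\<^sub>R (axis i 1, 0) - d_x i f z *\<^sub>R (0, axis i 1))"

lemma poisson_eq_derivative:
  assumes "g differentiable (at z)"
  shows "poisson f g z = frechet_derivative g (at z) (ham_vector f z)"
proof -
  interpret D: linear "frechet_derivative g (at z)"
    by (rule linear_frechet_derivative[OF assms])
  show ?thesis
    unfolding ham_vector_def poisson_def d_x_def d_p_def
    by (simp add: D.sum D.diff D.scale del: scaleR_Pair diff_Pair)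
qed

lemma poisson_antisym: "poisson g f = (\<lambda>z. - poisson f g z)"
  by (auto simp: poisson_def sum_negf[symmetric] algebra_simps)

lemma poisson_self: "poisson f f = (\<lambda>_. 0)"
  by (simp add: poisson_def)

lemma frechet_derivative_linear_combination:
  fixes F :: "nat \<Rightarrow> 'a::real_normed_vector \<Rightarrow> real"
  assumes "\<And>k. k < n \<Longrightarrow> F k differentiable (at z)"
  shows "((\<lambda>z. \<Sum>k<n. c k * F k z) has_derivative
      (\<lambda>v. \<Sum>k<n. c k * frechet_derivative (F k) (at z) v)) (at z)"
  using assms
  by (intro has_derivative_sum has_derivative_mult_right) (auto simp: frechet_derivative_works)

lemma poisson_sum_right:
  fixes n :: nat
  assumes "\<And>k. k < n \<Longrightarrow> F k differentiable (at z)"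
  shows "poisson f (\<lambda>z. \<Sum>k<n. c k * F k z) z = (\<Sum>k<n. c k * poisson f (F k) z)"
proof -
  have D: "((\<lambda>z. \<Sum>k<n. c k * F k z) has_derivative
      (\<lambda>v. \<Sum>k<n. c k * frechet_derivative (F k) (at z) v)) (at z)"
    by (rule frechet_derivative_linear_combination) (rule assms)
  then have "(\<lambda>z. \<Sum>k<n. c k * F k z) differentiable (at z)"
    by (auto simp: differentiable_def)
  then show ?thesis
    using assms by (simp add: poisson_eq_derivative frechet_derivative_eqI[OF D])
qed

subsection \<open>Hamiltonians that are linear on the fibres\<close>

lemma has_derivative_vec_frechet:
  fixes V :: "'a::real_normed_vector \<Rightarrow> real^'n"
  assumes "\<And>i. (\<lambda>y. V y $ i) differentiable (at x)"
  shows "(V has_derivative (\<lambda>u. \<chi> i. frechet_derivative (\<lambda>y. V y $ i) (at x) u)) (at x)"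
  using assms by (subst has_derivative_componentwise_within)
    (auto simp: Basis_vec_def inner_axis frechet_derivative_works[symmetric])

lemma has_derivative_ham:
  assumes "(V has_derivative V') (at x)"
  shows "(ham V has_derivative (\<lambda>(u, q). p \<bullet> V' u + q \<bullet> V x)) (at (x, p))"
proof -
  have "((\<lambda>z. V (fst z)) has_derivative (\<lambda>z. V' (fst z))) (at (x, p))"
    using has_derivative_compose[of fst fst "(x, p)" UNIV V V'] assms
    by (simp add: has_derivative_fst)
  from has_derivative_inner[OF has_derivative_snd[OF has_derivative_ident] this]
  show ?thesis
    by (simp add: ham_def case_prod_beta' add.commute)
qed

lemma smooth_ham:
  fixes V :: "'n::finite vfield"
  assumes "\<And>i. smooth (\<lambda>x. V x $ i)"
  shows "smooth (ham V)"
proof -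
  have "smooth (\<lambda>z :: 'n cotangent. snd z $ i)" for i
    by (intro smooth_bounded_linear bounded_linear_compose[OF bounded_linear_vec_nth]
        bounded_linear_snd)
  moreover have "smooth (\<lambda>z :: 'n cotangent. V (fst z) $ i)" for i
    using assms[of i]
      C_k_compose_bounded_linear[of "fst :: 'n cotangent \<Rightarrow> _", OF bounded_linear_fst,
        of _ "\<lambda>x. V x $ i"]
    by (simp add: smooth_def)
  ultimately have "smooth (\<lambda>z. \<Sum>i\<in>UNIV. snd z $ i * V (fst z) $ i)"
    by (intro smooth_sum smooth_mult)
  then show ?thesis
    by (simp add: ham_def inner_vec_def case_prod_beta')
qed

text \<open>The \<open>p\<close>-gradient of the Hamiltonian of \<open>V\<close> is \<open>V\<close> itself, and its
  \<open>x\<close>-gradient pairs with \<open>u\<close> to \<open>p \<bullet> DV(u)\<close>. Hence the canonical bracket is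
  \<open>p \<bullet> (DW(V) - DV(W))\<close>, which is \<open>p\<close> applied to the Lie bracket.\<close>

lemma poisson_ham:
  fixes V W :: "'n::finite vfield"
  assumes V: "\<And>i. smooth (\<lambda>x. V x $ i)" and W: "\<And>i. smooth (\<lambda>x. W x $ i)"
  shows "poisson (ham V) (ham W) = ham (lie_bracket V W)"
proof (rule ext, clarify)
  fix x p :: "real^'n"
  let ?D = "\<lambda>V u. \<chi> i. frechet_derivative (\<lambda>y. V y $ i) (at x) u"
  have dV: "(V has_derivative ?D V) (at x)" and dW: "(W has_derivative ?D W) (at x)"
    using V W by (auto intro!: has_derivative_vec_frechet smooth_imp_differentiable)
  interpret DV: linear "?D V" using has_derivative_linear[OF dV] .
  interpret DW: linear "?D W" using has_derivative_linear[OF dW] .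
  have basis: "(\<Sum>i\<in>UNIV. c $ i *\<^sub>R axis i 1) = c" for c :: "real^'n"
    by (simp add: basis_expansion scalar_mult_eq_scaleR[symmetric])
  have "poisson (ham V) (ham W) (x, p) =
      (\<Sum>i\<in>UNIV. V x $ i * (p \<bullet> ?D W (axis i 1)) - W x $ i * (p \<bullet> ?D V (axis i 1)))"
    unfolding poisson_def d_x_def d_p_def
      frechet_derivative_eqI[OF has_derivative_ham[OF dV]]
      frechet_derivative_eqI[OF has_derivative_ham[OF dW]]
    by (simp add: DV.zero DW.zero inner_axis' mult.commute del: vec_lambda_beta)
  also have "\<dots> = p \<bullet> ?D W (\<Sum>i\<in>UNIV. V x $ i *\<^sub>R axis i 1) - p \<bullet> ?D V (\<Sum>i\<in>UNIV. W x $ i *\<^sub>R axis i 1)"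
    by (simp add: DV.sum DW.sum DV.scale DW.scale inner_sum_right sum_subtractf)
  also have "\<dots> = ham (lie_bracket V W) (x, p)"
    unfolding basis ham_def lie_bracket_def vf_apply_def
    by (simp add: inner_diff_right[symmetric] vec_eq_iff minus_vec_def)
  finally show "poisson (ham V) (ham W) (x, p) = ham (lie_bracket V W) (x, p)" .
qed

subsection \<open>Spans of functions\<close>

lemma fun_span_nth: "k < length fs \<Longrightarrow> fs ! k \<in> fun_span fs"
  unfolding fun_span_def
  by (auto intro!: exI[of _ "\<lambda>i. of_bool (i = k)"])

lemma fun_span_base: "f \<in> set fs \<Longrightarrow> f \<in> fun_span fs"
  by (auto simp: in_set_conv_nth fun_span_nth)

lemma fun_span_zero: "(\<lambda>_. 0) \<in> fun_span fs"
  unfolding fun_span_def by (auto intro!: exI[of _ "\<lambda>_. 0"])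

lemma fun_span_scale: "f \<in> fun_span fs \<Longrightarrow> (\<lambda>z. a * f z) \<in> fun_span fs"
  unfolding fun_span_def
proof clarify
  fix c
  show "\<exists>d. (\<lambda>z. a * (\<Sum>k<length fs. c k * (fs ! k) z)) =
      (\<lambda>z. \<Sum>k<length fs. d k * (fs ! k) z)"
    by (auto simp: sum_distrib_left mult.assoc intro!: exI[of _ "\<lambda>k. a * c k"])
qed

lemma fun_span_uminus: "f \<in> fun_span fs \<Longrightarrow> (\<lambda>z. - f z) \<in> fun_span fs"
  using fun_span_scale[of f fs "-1"] by simp

lemma fun_span_add:
  assumes "f \<in> fun_span fs" "g \<in> fun_span fs"
  shows "(\<lambda>z. f z + g z) \<in> fun_span fs"
proof -
  obtain c d where "f = (\<lambda>z. \<Sum>k<length fs. c k * (fs ! k) z)"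
    "g = (\<lambda>z. \<Sum>k<length fs. d k * (fs ! k) z)"
    using assms unfolding fun_span_def by auto
  then show ?thesis
    unfolding fun_span_def
    by (auto simp: sum.distrib distrib_right intro!: exI[of _ "\<lambda>k. c k + d k"])
qed

lemma fun_span_sum:
  "(\<And>i. i \<in> S \<Longrightarrow> f i \<in> fun_span fs) \<Longrightarrow> (\<lambda>z. \<Sum>i\<in>S. f i z) \<in> fun_span fs"
  by (induction S rule: infinite_finite_induct) (simp_all add: fun_span_zero fun_span_add)

lemma smooth_fun_span:
  assumes "\<And>f. f \<in> set fs \<Longrightarrow> smooth f" "f \<in> fun_span fs"
  shows "smooth f"
  using assms unfolding fun_span_def by (auto intro!: smooth_sum)

text \<open>A bracket is linear in its second argument on linear combinations of smooth functions, so a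
  subspace that contains the brackets with the generators contains those with the whole span.\<close>

lemma poisson_fun_span_right:
  assumes smooth: "\<And>f. f \<in> set fs \<Longrightarrow> smooth f"
    and gens: "\<And>g. g \<in> set fs \<Longrightarrow> poisson f g \<in> fun_span hs"
    and g: "g \<in> fun_span fs"
  shows "poisson f g \<in> fun_span hs"
proof -
  obtain c where c: "g = (\<lambda>z. \<Sum>k<length fs. c k * (fs ! k) z)"
    using g unfolding fun_span_def by auto
  have "poisson f g = (\<lambda>z. \<Sum>k<length fs. c k * poisson f (fs ! k) z)"
    unfolding c using smooth
    by (intro ext poisson_sum_right smooth_imp_differentiable) simp
  then show ?thesis
    using gens by (auto intro!: fun_span_sum fun_span_scale)
qed

lemma poisson_fun_span:
  assumes smooth: "\<And>f. f \<in> set fs \<Longrightarrow> smooth f"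
    and gens: "\<And>f g. f \<in> set fs \<Longrightarrow> g \<in> set fs \<Longrightarrow> poisson f g \<in> fun_span hs"
    and f: "f \<in> fun_span fs" and g: "g \<in> fun_span fs"
  shows "poisson f g \<in> fun_span hs"
proof (rule poisson_fun_span_right[OF smooth _ g])
  fix k assume "k \<in> set fs"
  then have "poisson k f \<in> fun_span hs"
    by (intro poisson_fun_span_right[OF smooth gens f])
  then show "poisson f k \<in> fun_span hs"
    by (subst poisson_antisym) (rule fun_span_uminus)
qed

lemma poisson_closedI:
  assumes "\<And>f. f \<in> set fs \<Longrightarrow> smooth f"
    and "\<And>f g. f \<in> set fs \<Longrightarrow> g \<in> set fs \<Longrightarrow> poisson f g \<in> fun_span fs"
  shows "poisson_closed (fun_span fs)"
  unfolding poisson_closed_def using poisson_fun_span[OF assms] by blast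

text \<open>The span of no functions is the zero space, so the closure lemmas above, with \<open>hs = []\<close>,
  also prove that all brackets vanish.\<close>

lemma fun_span_Nil: "fun_span [] = {\<lambda>_. 0}"
  by (auto simp: fun_span_def)

lemma poisson_abelianI:
  assumes "\<And>f. f \<in> set fs \<Longrightarrow> smooth f"
    and "\<And>f g. f \<in> set fs \<Longrightarrow> g \<in> set fs \<Longrightarrow> poisson f g = (\<lambda>_. 0)"
  shows "poisson_abelian (fun_span fs)"
  unfolding poisson_abelian_def
  using poisson_fun_span[of fs "[]"] assms by (auto simp: fun_span_Nil)

lemma is_integral_fun_span:
  assumes "\<And>f. f \<in> set fs \<Longrightarrow> is_integral H f" "f \<in> fun_span fs"
  shows "is_integral H f"
  using poisson_fun_span_right[of fs H "[]" f] smooth_fun_span[of fs f] assms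
  by (auto simp: is_integral_def fun_span_Nil)

section \<open>The frames on the group\<close>

lemma exhaust_8:
  fixes i :: 8
  shows "i = 1 \<or> i = 2 \<or> i = 3 \<or> i = 4 \<or> i = 5 \<or> i = 6 \<or> i = 7 \<or> i = 8"
proof (induct i)
  case (of_int z)
  then have "z = 0 \<or> z = 1 \<or> z = 2 \<or> z = 3 \<or> z = 4 \<or> z = 5 \<or> z = 6 \<or> z = 7"
    by simp arith
  then show ?case by auto
qed

lemma forall_8: "(\<forall>i::8. P i) \<longleftrightarrow> P 1 \<and> P 2 \<and> P 3 \<and> P 4 \<and> P 5 \<and> P 6 \<and> P 7 \<and> P 8"
  by (metis exhaust_8)

lemma vec8_eq_iff: "x = y \<longleftrightarrow> x$1 = y$1 \<and> x$2 = y$2 \<and> x$3 = y$3 \<and> x$4 = y$4 \<and> x$5 = y$5 \<and>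
    x$6 = y$6 \<and> x$7 = y$7 \<and> x$8 = (y::'a^8)$8"
  by (simp add: vec_eq_iff forall_8)

lemma all_index_8: "(\<forall>i\<in>{1..8::nat}. P i) \<longleftrightarrow>
    P 1 \<and> P 2 \<and> P 3 \<and> P 4 \<and> P 5 \<and> P 6 \<and> P 7 \<and> P 8"
proof -
  have "{1..8::nat} = {1,2,3,4,5,6,7,8}" by auto
  then show ?thesis by simp
qed

lemma axis_component: "axis i a $ j = (if i = j then a else 0)"
  by (simp add: axis_def)

lemma X3_eq: "X3 x = Dx 3 + x$1 *\<^sub>R Dx 4 + x$2 *\<^sub>R Dx 5 + ((x$1)\<^sup>2 / 2) *\<^sub>R Dx 6
    + (x$1 * x$2) *\<^sub>R Dx 7 + ((x$2)\<^sup>2 / 2) *\<^sub>R Dx 8"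
  unfolding X3_def lie_bracket_def
  by (simp add: vec8_eq_iff X1_def X2_def axis_component field_simps power2_eq_square)

lemma X4_eq: "X4 x = Dx 4 + x$1 *\<^sub>R Dx 6 + x$2 *\<^sub>R Dx 7"
  unfolding X4_def lie_bracket_def
  by (simp add: vec8_eq_iff X1_def X3_eq axis_component)

lemma X5_eq: "X5 x = Dx 5 + x$1 *\<^sub>R Dx 7 + x$2 *\<^sub>R Dx 8"
  unfolding X5_def lie_bracket_def
  by (simp add: vec8_eq_iff X2_def X3_eq axis_component)

lemma X6_eq: "X6 x = Dx 6"
  unfolding X6_def lie_bracket_def
  by (simp add: vec8_eq_iff X1_def X4_eq axis_component)

lemma X7_eq: "X7 x = Dx 7"
  unfolding X7_def lie_bracket_def
  by (simp add: vec8_eq_iff X1_def X5_eq axis_component)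

lemma X8_eq: "X8 x = Dx 8"
  unfolding X8_def lie_bracket_def
  by (simp add: vec8_eq_iff X2_def X5_eq axis_component)

lemma X_nth [simp]: "X 0 = X0" "X 1 = X1" "X (Suc 0) = X1" "X 2 = X2" "X 3 = X3" "X 4 = X4" "X 5 = X5"
  "X 6 = X6" "X 7 = X7" "X 8 = X8"
  by (simp_all add: X_def)

lemmas frame_eqs = X1_def X2_def X3_eq X4_eq X5_eq X6_eq X7_eq X8_eq axis_component

text \<open>Obtained by integrating the differential of a left translation, which is prescribed by
  left invariance, from its value \<open>a\<close> at \<open>x = 0\<close>. In every coordinate the sum
  \<open>a$k + x$k\<close> is corrected by terms that involve only coordinates of smaller weight.\<close>

definition group_mult :: "real^8 \<Rightarrow> real^8 \<Rightarrow> real^8" where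
  "group_mult a x =
    (a$1 + x$1) *\<^sub>R Dx 1
    + (a$2 + x$2) *\<^sub>R Dx 2
    + (a$3 + x$3 + (a$1 * x$2 - a$2 * x$1) / 2) *\<^sub>R Dx 3
    + (a$4 + x$4 + a$1 * x$3 + ((a$1)\<^sup>2 + (a$2)\<^sup>2) * x$2 / 2
        + (a$1 * x$1 + a$2 * x$2) * x$2 / 2) *\<^sub>R Dx 4
    + (a$5 + x$5 + a$2 * x$3 - ((a$1)\<^sup>2 + (a$2)\<^sup>2) * x$1 / 2
        - (a$1 * x$1 + a$2 * x$2) * x$1 / 2) *\<^sub>R Dx 5
    + (a$6 + x$6 + a$1 * x$4 + (a$1)\<^sup>2 * x$3 / 2 + (a$1)^3 * x$2 / 6
        + (a$1)\<^sup>2 * x$1 * x$2 / 4 - a$1 * (x$2)^3 / 6) *\<^sub>R Dx 6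
    + (a$7 + x$7 + a$1 * x$5 + a$2 * x$4 + a$1 * a$2 * x$3
        + a$1 * a$2 * (a$1 * x$2 - a$2 * x$1) / 4
        + ((a$1)\<^sup>2 * (x$2)\<^sup>2 - (a$2)\<^sup>2 * (x$1)\<^sup>2) / 8
        + a$1 * (x$1)^3 / 6 - a$2 * (x$2)^3 / 6
        + (a$1 * x$2 - a$2 * x$1) * x$1 * x$2 / 4) *\<^sub>R Dx 7
    + (a$8 + x$8 + a$2 * x$5 + (a$2)\<^sup>2 * x$3 / 2 - (a$2)^3 * x$1 / 6
        - (a$2)\<^sup>2 * x$1 * x$2 / 4 + a$2 * (x$1)^3 / 6) *\<^sub>R Dx 8"

lemma group_mult_zero_right: "group_mult a 0 = a"
  by (simp add: vec8_eq_iff group_mult_def axis_component)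

lemma differentiable_group_mult_right: "(\<lambda>x. group_mult a x $ k) differentiable (at x)"
proof -
  have "\<forall>k. (\<lambda>x. group_mult a x $ k) differentiable (at x)"
    by (simp add: forall_8 group_mult_def axis_component)
  then show ?thesis ..
qed

lemma differentiable_group_mult_left: "(\<lambda>a. group_mult a x $ k) differentiable (at a)"
proof -
  have "\<forall>k. (\<lambda>a. group_mult a x $ k) differentiable (at a)"
    by (simp add: forall_8 group_mult_def axis_component)
  then show ?thesis ..
qed

lemma X_group_mult:
  assumes "i \<in> {1..8}"
  shows "vf_apply (X i) (\<lambda>y. group_mult a y $ k) x = X i (group_mult a x) $ k"
proof -
  have "\<forall>i\<in>{1..8}. \<forall>k. vf_apply (X i) (\<lambda>y. group_mult a y $ k) x = X i (group_mult a x) $ k"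
    unfolding all_index_8 forall_8
    by (simp add: group_mult_def frame_eqs power2_eq_square power3_eq_cube field_simps)
  then show ?thesis using assms by blast
qed

text \<open>Minus the derivative of \<^const>\<open>group_mult\<close> in its first argument \<open>a\<close>, at the identity
  and along the \<open>j\<close>-th coordinate. For \<open>j \<ge> 3\<close> it is constant because \<open>a$j\<close> enters the product
  only as an additive term of the \<open>j\<close>-th coordinate.\<close>

definition right_field :: "nat \<Rightarrow> 8 vfield" where
  "right_field j x =
    (if j = 1 then
       - Dx 1 - (x$2 / 2) *\<^sub>R Dx 3 - (x$1 * x$2 / 2 + x$3) *\<^sub>R Dx 4 + ((x$1)\<^sup>2 / 2) *\<^sub>R Dx 5
         + ((x$2)^3 / 6 - x$4) *\<^sub>R Dx 6 - ((x$1)^3 / 6 + x$1 * (x$2)\<^sup>2 / 4 + x$5) *\<^sub>R Dx 7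
     else if j = 2 then
       - Dx 2 + (x$1 / 2) *\<^sub>R Dx 3 - ((x$2)\<^sup>2 / 2) *\<^sub>R Dx 4 + (x$1 * x$2 / 2 - x$3) *\<^sub>R Dx 5
         + ((x$1)\<^sup>2 * x$2 / 4 + (x$2)^3 / 6 - x$4) *\<^sub>R Dx 7 - ((x$1)^3 / 6 + x$5) *\<^sub>R Dx 8
     else - Dx (of_nat j))"

lemma right_field_group_mult:
  assumes "j \<in> {1..8}"
  shows "vf_apply (\<lambda>_. - X j 0) (\<lambda>y. group_mult y a $ k) 0 = right_field j a $ k"
proof -
  have "\<forall>j\<in>{1..8}. \<forall>k. vf_apply (\<lambda>_. - X j 0) (\<lambda>y. group_mult y a $ k) 0 = right_field j a $ k"
    unfolding all_index_8 forall_8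
    by (simp add: group_mult_def right_field_def frame_eqs power2_eq_square field_simps)
  then show ?thesis using assms by blast
qed

lemma frechet_derivative_vec_component:
  assumes "(F::'a::real_normed_vector \<Rightarrow> real^'n) differentiable (at x)"
  shows "frechet_derivative (\<lambda>y. F y $ k) (at x) v = frechet_derivative F (at x) v $ k"
    and "(\<lambda>y. F y $ k) differentiable (at x)"
proof -
  have "((\<lambda>y. F y $ k) has_derivative (\<lambda>v. frechet_derivative F (at x) v $ k)) (at x)"
    using assms
    by (intro bounded_linear.has_derivative[OF bounded_linear_vec_nth])
      (simp add: frechet_derivative_works)
  then show "frechet_derivative (\<lambda>y. F y $ k) (at x) v = frechet_derivative F (at x) v $ k"
    and "(\<lambda>y. F y $ k) differentiable (at x)"
    by (auto simp: frechet_derivative_eqI differentiable_def)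
qed

text \<open>The frame is unitriangular with respect to the coordinate fields, so these can be recovered
  from it, starting with the last one.\<close>

lemma linear_vanishing_on_frame:
  fixes D :: "real^8 \<Rightarrow> real"
  assumes "linear D" and "\<And>i. i \<in> {1..8} \<Longrightarrow> D (X i x) = 0"
  shows "D = (\<lambda>_. 0)"
proof -
  interpret D: linear D by fact
  have "\<forall>i\<in>{1..8}. D (X i x) = 0"
    using assms(2) by blast
  then have "D (axis i 1) = 0" for i
    unfolding all_index_8
    using exhaust_8[of i]
    by (auto simp: X1_def X2_def X3_eq X4_eq X5_eq X6_eq X7_eq X8_eq D.add D.diff D.scale)
  then have "D (\<Sum>i\<in>UNIV. v $ i *\<^sub>R axis i 1) = 0" for v :: "real^8"
    by (simp add: D.sum D.scale)
  then have "D v = 0" for v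
    by (simp add: basis_expansion scalar_mult_eq_scaleR[symmetric])
  then show ?thesis by auto
qed

text \<open>A function whose derivatives along a frame are given is determined by one value, because the
  difference of two such functions has zero differential on a connected space.\<close>

lemma eq_if_frame_derivatives_eq:
  fixes f g :: "real^8 \<Rightarrow> real"
  assumes f: "\<And>x. f differentiable (at x)" and g: "\<And>x. g differentiable (at x)"
    and eq: "\<And>i x. i \<in> {1..8} \<Longrightarrow> vf_apply (X i) f x = vf_apply (X i) g x"
    and 0: "f 0 = g 0"
  shows "f x = g x"
proof -
  have d: "((\<lambda>y. f y - g y) has_derivative
      (\<lambda>v. frechet_derivative f (at x) v - frechet_derivative g (at x) v)) (at x)" for x
    using f g by (intro has_derivative_diff) (auto simp: frechet_derivative_works)
  have "(\<lambda>v. frechet_derivative f (at x) v - frechet_derivative g (at x) v) = (\<lambda>_. 0)" for x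
    using eq by (intro linear_vanishing_on_frame[OF has_derivative_linear[OF d]]) (auto simp: vf_apply_def)
  then have "((\<lambda>y. f y - g y) has_derivative (\<lambda>_. 0)) (at x)" for x
    using d[of x] by simp
  then have "f x - g x = f 0 - g 0"
    using has_derivative_zero_unique[of UNIV "\<lambda>y. f y - g y" x 0] by simp
  then show ?thesis using 0 by simp
qed

text \<open>The coefficients are functions of the first two coordinates only, and the first two
  coefficients are constant. Consequently the equations for a left translation can be solved for
  the first two coordinates before the others.\<close>

lemma X_depends_on_horizontal:
  assumes "i \<in> {1..8}" "y $ 1 = z $ 1" "y $ 2 = z $ 2"
  shows "X i y = X i z"
proof -
  have "\<forall>i\<in>{1..8}. X i y = X i z"
    unfolding all_index_8 using assms
    by (simp add: X1_def X2_def X3_eq X4_eq X5_eq X6_eq X7_eq X8_eq)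
  then show ?thesis using assms by blast
qed

lemma X_horizontal_const:
  assumes "i \<in> {1..8}" "k = 1 \<or> k = 2"
  shows "X i y $ k = X i z $ k"
proof -
  have "\<forall>i\<in>{1..8}. X i y $ k = X i z $ k"
    unfolding all_index_8 using assms(2) by (auto simp: frame_eqs)
  then show ?thesis using assms by blast
qed

lemma differentiable_left_translation:
  assumes "lie_group_on G"
  shows "(\<lambda>y. a \<otimes>\<^bsub>G\<^esub> y) differentiable (at x)"
proof -
  have "(\<lambda>(x, y). x \<otimes>\<^bsub>G\<^esub> y) differentiable (at (a, x))"
    using assms by (auto simp: lie_group_on_def intro: smooth_imp_differentiable)
  then have "((\<lambda>(x, y). x \<otimes>\<^bsub>G\<^esub> y) has_derivative
      frechet_derivative (\<lambda>(x, y). x \<otimes>\<^bsub>G\<^esub> y) (at (a, x))) (at (a, x))"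
    by (simp add: frechet_derivative_works)
  moreover have "((\<lambda>y. (a, y)) has_derivative (\<lambda>v. (0, v))) (at x)"
    by (intro has_derivative_Pair has_derivative_const has_derivative_ident)
  ultimately have "((\<lambda>y. (\<lambda>(x, y). x \<otimes>\<^bsub>G\<^esub> y) (a, y)) has_derivative
      (\<lambda>v. frechet_derivative (\<lambda>(x, y). x \<otimes>\<^bsub>G\<^esub> y) (at (a, x)) (0, v))) (at x)"
    by (rule has_derivative_compose[rotated])
  then show ?thesis by (auto simp: differentiable_def)
qed

text \<open>Left invariance prescribes the derivatives of every coordinate of \<open>a \<otimes> x\<close> along the
  frame. For the first two coordinates they are constants, so these coordinates agree with
  \<^const>\<open>group_mult\<close>; then the derivatives of the other coordinates agree as well, because the
  coefficients of the frame see only the first two.\<close>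

lemma mult_eq_group_mult:
  assumes G: "lie_group_on G" "\<one>\<^bsub>G\<^esub> = 0"
    and X_left: "\<forall>i\<in>{1..8}. left_invariant G (X i)"
  shows "a \<otimes>\<^bsub>G\<^esub> x = group_mult a x"
proof -
  have unit: "a \<otimes>\<^bsub>G\<^esub> 0 = a"
    using G monoid.r_one[of G a] by (simp add: lie_group_on_def group.is_monoid)
  note trans = differentiable_left_translation[OF G(1), of a]
  have diff: "(\<lambda>y. (a \<otimes>\<^bsub>G\<^esub> y) $ k) differentiable (at x)" for k x
    by (rule frechet_derivative_vec_component(2)[OF trans])
  have frame: "vf_apply (X i) (\<lambda>y. (a \<otimes>\<^bsub>G\<^esub> y) $ k) x = X i (a \<otimes>\<^bsub>G\<^esub> x) $ k"
    if "i \<in> {1..8}" for i k x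
    using X_left that
    by (simp add: vf_apply_def frechet_derivative_vec_component(1)[OF trans] left_invariant_def)
  have comp: "(a \<otimes>\<^bsub>G\<^esub> x) $ k = group_mult a x $ k"
    if eq: "\<And>i x. i \<in> {1..8} \<Longrightarrow> X i (a \<otimes>\<^bsub>G\<^esub> x) $ k = X i (group_mult a x) $ k" for k x
  proof (rule eq_if_frame_derivatives_eq[where f = "\<lambda>y. (a \<otimes>\<^bsub>G\<^esub> y) $ k"])
    show "vf_apply (X i) (\<lambda>y. (a \<otimes>\<^bsub>G\<^esub> y) $ k) x = vf_apply (X i) (\<lambda>y. group_mult a y $ k) x"
      if "i \<in> {1..8}" for i x
      unfolding frame[OF that] X_group_mult[OF that] by (rule eq[OF that])
  qed (simp_all add: diff differentiable_group_mult_right unit group_mult_zero_right)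
  have horizontal: "(a \<otimes>\<^bsub>G\<^esub> x) $ k = group_mult a x $ k" if "k = 1 \<or> k = 2" for k x
    by (rule comp) (rule X_horizontal_const[OF _ that])
  have "(a \<otimes>\<^bsub>G\<^esub> x) $ k = group_mult a x $ k" for k
    by (rule comp) (simp add: X_depends_on_horizontal[of _ "a \<otimes>\<^bsub>G\<^esub> _"] horizontal)
  then show ?thesis by (simp add: vec_eq_iff)
qed

text \<open>A right-invariant field is transported from the identity by right translations, which are
  known explicitly once the multiplication is.\<close>

lemma right_invariant_eq_right_field:
  assumes G: "lie_group_on G" "\<one>\<^bsub>G\<^esub> = 0"
    and X_left: "\<forall>i\<in>{1..8}. left_invariant G (X i)"
    and j: "j \<in> {1..8}" and Z: "right_invariant G Z" "Z 0 = - X j 0"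
  shows "Z = right_field j"
proof
  fix a
  note mult = mult_eq_group_mult[OF G X_left]
  have unit: "group_mult 0 a = a"
    using G monoid.l_one[of G a] by (simp add: lie_group_on_def group.is_monoid mult)
  have diff: "(\<lambda>y. group_mult y a) differentiable (at 0)"
    using has_derivative_vec_frechet[OF differentiable_group_mult_left] by (auto simp: differentiable_def)
  have "Z a = frechet_derivative (\<lambda>y. group_mult y a) (at 0) (- X j 0)"
    using Z(1)[unfolded right_invariant_def mult, rule_format, of a 0] Z(2) by (simp add: unit)
  then have "Z a $ k = vf_apply (\<lambda>_. - X j 0) (\<lambda>y. group_mult y a $ k) 0" for k
    by (simp add: vf_apply_def frechet_derivative_vec_component(1)[OF diff])
  then show "Z a = right_field j a"
    using right_field_group_mult[OF j] by (simp add: vec_eq_iff)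
qed

section \<open>Brackets of the vector fields\<close>

lemma smooth_X_component:
  assumes "i \<in> {1..8}"
  shows "smooth (\<lambda>x. X i x $ k)"
proof -
  have "\<forall>i\<in>{1..8}. \<forall>k. smooth (\<lambda>x. X i x $ k)"
    unfolding all_index_8 forall_8 by (simp add: frame_eqs)
  then show ?thesis using assms by blast
qed

lemma smooth_X0_component: "smooth (\<lambda>x. X0 x $ k)"
proof -
  have "\<forall>k. smooth (\<lambda>x. X0 x $ k)"
    unfolding forall_8 by (simp add: X0_def axis_component)
  then show ?thesis by blast
qed

lemma smooth_right_field_component:
  assumes "j \<in> {1..8}"
  shows "smooth (\<lambda>x. right_field j x $ k)"
proof -
  have "\<forall>j\<in>{1..8}. \<forall>k. smooth (\<lambda>x. right_field j x $ k)"
    unfolding all_index_8 forall_8 by (simp add: right_field_def axis_component)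
  then show ?thesis using assms by blast
qed

text \<open>At every point the right-invariant fields form a unitriangular frame up to sign.\<close>

lemma right_field_frame:
  assumes "\<And>k. (\<Sum>j=1..8. c j * right_field j x $ k) = 0" "j \<in> {1..8}"
  shows "c j = 0"
proof -
  have S: "(\<Sum>j=1..8. f j) = f 1 + f 2 + f 3 + f 4 + f 5 + f 6 + f 7 + f (8::nat)" for f :: "nat \<Rightarrow> real"
    by (simp add: numeral_eq_Suc)
  have "\<forall>k. (\<Sum>j=1..8. c j * right_field j x $ k) = 0" using assms by blast
  then have "\<forall>j\<in>{1..8}. c j = 0"
    unfolding forall_8 all_index_8 S
    by (auto simp: right_field_def axis_component)
  then show ?thesis using assms by blast
qed

lemma right_field_const: "3 \<le> j \<Longrightarrow> right_field j = (\<lambda>_. - Dx (of_nat j))"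
  by (auto simp: right_field_def)

lemmas field_eq_simps = fun_eq_iff vec8_eq_iff lie_bracket_component frame_eqs right_field_def
  power2_eq_square power3_eq_cube field_simps

lemma lie_bracket_X_right_field_1:
  "lie_bracket X1 (right_field 1) = (\<lambda>_. 0)"
  "lie_bracket X2 (right_field 1) = (\<lambda>_. 0)"
  "lie_bracket X3 (right_field 1) = (\<lambda>_. 0)"
  by (simp_all add: field_eq_simps)

lemma lie_bracket_X_right_field_2:
  "lie_bracket X1 (right_field 2) = (\<lambda>_. 0)"
  "lie_bracket X2 (right_field 2) = (\<lambda>_. 0)"
  "lie_bracket X3 (right_field 2) = (\<lambda>_. 0)"
  by (simp_all add: field_eq_simps)

lemma lie_bracket_X_vertical_const:
  assumes "b $ 1 = 0" "b $ 2 = 0"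
  shows "lie_bracket X1 (\<lambda>_. b) = (\<lambda>_. 0)" "lie_bracket X2 (\<lambda>_. b) = (\<lambda>_. 0)"
    "lie_bracket X3 (\<lambda>_. b) = (\<lambda>_. 0)"
  using assms by (simp_all add: fun_eq_iff vec8_eq_iff lie_bracket_component frame_eqs)

text \<open>Left-invariant and right-invariant fields commute since left and right translations do. Only
  \<open>X 1\<close> and \<open>X 2\<close>, which make up the Hamiltonian, and \<open>X 3\<close>, which serves in the
  proof of independence, are of interest.\<close>

lemma lie_bracket_X_right_field:
  assumes "i \<in> {1, 2, 3}" "j \<in> {1..8}"
  shows "lie_bracket (X i) (right_field j) = (\<lambda>_. 0)"
proof -
  consider "j = 1" | "j = 2" | "j \<ge> 3"
    using assms(2) by fastforce
  then show ?thesis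
  proof cases
    case 3
    have "j = 3 \<or> j = 4 \<or> j = 5 \<or> j = 6 \<or> j = 7 \<or> j = 8"
      using 3 assms(2) by auto
    then have "(- Dx (of_nat j)) $ 1 = 0" "(- Dx (of_nat j)) $ 2 = 0"
      by (auto simp: axis_component)
    from lie_bracket_X_vertical_const[OF this] show ?thesis
      using assms(1) unfolding right_field_const[OF 3] by auto
  qed (use assms(1) in \<open>auto simp: lie_bracket_X_right_field_1 lie_bracket_X_right_field_2
      simp del: One_nat_def\<close>)
qed

text \<open>The field \<open>X0\<close> acts on the plane spanned by \<open>X1\<close> and \<open>X2\<close> as an infinitesimal
  rotation, which preserves the sum of squares of their Hamiltonians.\<close>

lemma lie_bracket_X1_X0: "lie_bracket X1 X0 = (\<lambda>x. - X2 x)"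
  by (simp add: field_eq_simps X0_def power4_eq_xxxx)

lemma lie_bracket_X2_X0: "lie_bracket X2 X0 = X1"
  by (simp add: field_eq_simps X0_def power4_eq_xxxx)

lemma lie_bracket_X3_X0: "lie_bracket X3 X0 = (\<lambda>_. 0)"
  by (simp add: field_eq_simps X0_def power4_eq_xxxx)

lemma lie_bracket_X3_X1: "lie_bracket X3 X1 = (\<lambda>x. - X4 x)"
  unfolding X4_def by (rule lie_bracket_antisym)

lemma lie_bracket_X3_X2: "lie_bracket X3 X2 = (\<lambda>x. - X5 x)"
  unfolding X5_def by (rule lie_bracket_antisym)

lemma lie_bracket_X0_right_field_1: "lie_bracket X0 (right_field 1) = right_field 2"
  by (simp add: field_eq_simps X0_def power4_eq_xxxx)

lemma lie_bracket_X0_right_field_2: "lie_bracket X0 (right_field 2) = (\<lambda>x. - right_field 1 x)"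
  by (simp add: field_eq_simps X0_def power4_eq_xxxx)

lemma lie_bracket_X0_right_field_vertical:
  "lie_bracket X0 (right_field 3) = (\<lambda>_. 0)"
  "lie_bracket X0 (right_field 4) = right_field 5"
  "lie_bracket X0 (right_field 5) = (\<lambda>x. - right_field 4 x)"
  "lie_bracket X0 (right_field 6) = (\<lambda>x. 2 *\<^sub>R right_field 7 x)"
  "lie_bracket X0 (right_field 7) = (\<lambda>x. right_field 8 x - right_field 6 x)"
  "lie_bracket X0 (right_field 8) = (\<lambda>x. - 2 *\<^sub>R right_field 7 x)"
  by (simp_all add: fun_eq_iff vec8_eq_iff lie_bracket_component right_field_def axis_component X0_def)

lemma lie_bracket_right_field_1_2: "lie_bracket (right_field 1) (right_field 2) = right_field 3"
  by (simp add: field_eq_simps)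

lemma lie_bracket_right_field_vertical:
  "lie_bracket (right_field 1) (right_field 3) = right_field 4"
  "lie_bracket (right_field 2) (right_field 3) = right_field 5"
  "lie_bracket (right_field 1) (right_field 4) = right_field 6"
  "lie_bracket (right_field 1) (right_field 5) = right_field 7"
  "lie_bracket (right_field 2) (right_field 4) = right_field 7"
  "lie_bracket (right_field 2) (right_field 5) = right_field 8"
  by (simp_all add: fun_eq_iff vec8_eq_iff lie_bracket_component right_field_def axis_component)

lemma lie_bracket_right_field_central:
  "lie_bracket (right_field 1) (right_field 6) = (\<lambda>_. 0)"
  "lie_bracket (right_field 1) (right_field 7) = (\<lambda>_. 0)"
  "lie_bracket (right_field 1) (right_field 8) = (\<lambda>_. 0)"
  "lie_bracket (right_field 2) (right_field 6) = (\<lambda>_. 0)"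
  "lie_bracket (right_field 2) (right_field 7) = (\<lambda>_. 0)"
  "lie_bracket (right_field 2) (right_field 8) = (\<lambda>_. 0)"
  by (simp_all add: fun_eq_iff vec8_eq_iff lie_bracket_component right_field_def axis_component)

lemma lie_bracket_right_field_zero:
  assumes "i \<in> {1..8}" "j \<in> {1..8}" "i < j"
    and "(i, j) \<notin> {(1,2), (1,3), (2,3), (1,4), (1,5), (2,4), (2,5)}"
  shows "lie_bracket (right_field i) (right_field j) = (\<lambda>_. 0)"
proof (cases "i \<ge> 3")
  case True
  with \<open>i < j\<close> show ?thesis
    by (simp add: right_field_const lie_bracket_const)
next
  case False
  have "\<forall>i\<in>{1..8}. \<forall>j\<in>{1..8}. i < j \<longrightarrow>
      (i, j) \<notin> {(1,2), (1,3), (2,3), (1,4), (1,5), (2,4), (2,5)} \<longrightarrow> \<not> i \<ge> 3 \<longrightarrow>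
      lie_bracket (right_field i) (right_field j) = (\<lambda>_. 0)"
    unfolding all_index_8 by (simp add: lie_bracket_right_field_central[simplified])
  then show ?thesis using assms False by blast
qed

section \<open>Integrals of the normal Hamiltonian field\<close>

lemma ham_zero [simp]: "ham (\<lambda>_. 0) = (\<lambda>_. 0)"
  by (auto simp: ham_def)

lemma ham_uminus: "ham (\<lambda>x. - V x) = (\<lambda>z. - ham V z)"
  by (auto simp: ham_def)

lemma ham_diff: "ham (\<lambda>x. V x - W x) = (\<lambda>z. ham V z - ham W z)"
  by (auto simp: ham_def inner_diff_right)

lemma ham_scaleR: "ham (\<lambda>x. a *\<^sub>R V x) = (\<lambda>z. a * ham V z)"
  by (auto simp: ham_def)

lemma smooth_ham_X [simp]: "i \<in> {1..8} \<Longrightarrow> smooth (ham (X i))"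
  by (intro smooth_ham smooth_X_component)

lemma smooth_ham_X0 [simp]: "smooth (ham X0)"
  by (intro smooth_ham smooth_X0_component)

lemma smooth_ham_right_field [simp]: "j \<in> {1..8} \<Longrightarrow> smooth (ham (right_field j))"
  by (intro smooth_ham smooth_right_field_component)

definition hamiltonian :: "8 cotangent \<Rightarrow> real" where
  "hamiltonian z = ((ham (X 1) z)\<^sup>2 + (ham (X 2) z)\<^sup>2) / 2"

lemma smooth_hamiltonian [simp]: "smooth hamiltonian"
  unfolding hamiltonian_def[abs_def]
  by (intro smooth_divide_const smooth_add smooth_power smooth_ham_X) simp_all

lemma poisson_hamiltonian_right:
  "poisson f hamiltonian z =
    ham (X 1) z * poisson f (ham (X 1)) z + ham (X 2) z * poisson f (ham (X 2)) z"
proof -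
  have d: "ham (X i) differentiable (at z)" if "i \<in> {1..8}" for i
    using that by (intro smooth_imp_differentiable smooth_ham_X)
  let ?D = "\<lambda>i. frechet_derivative (ham (X i)) (at z)"
  have D: "(hamiltonian has_derivative (\<lambda>v. ham (X 1) z * ?D 1 v + ham (X 2) z * ?D 2 v)) (at z)"
    unfolding hamiltonian_def[abs_def]
    by (rule derivative_eq_intros d[unfolded frechet_derivative_works] refl | simp)+
      (simp add: fun_eq_iff field_simps)
  then have "hamiltonian differentiable (at z)"
    by (auto simp: differentiable_def)
  then show ?thesis
    using d[of 1] d[of 2] by (simp add: poisson_eq_derivative frechet_derivative_eqI[OF D])
qed

lemma poisson_X_right_field:
  assumes "i \<in> {1, 2, 3}" "j \<in> {1..8}"
  shows "poisson (ham (X i)) (ham (right_field j)) = (\<lambda>_. 0)"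
proof -
  have "i \<in> {1..8}" using assms by auto
  then show ?thesis
    using assms by (subst poisson_ham)
      (simp_all add: lie_bracket_X_right_field smooth_X_component smooth_right_field_component del: insert_iff)
qed

lemma poisson_hamiltonian_right_field:
  assumes "j \<in> {1..8}"
  shows "poisson hamiltonian (ham (right_field j)) = (\<lambda>_. 0)"
proof -
  have "poisson (ham (right_field j)) (ham (X i)) = (\<lambda>_. 0)" if "i \<in> {1, 2, 3}" for i
    using poisson_X_right_field[OF that assms] poisson_antisym[of "ham (right_field j)"] by simp
  from this[of 1] this[of 2] show ?thesis
    by (subst poisson_antisym) (simp add: poisson_hamiltonian_right)
qed

lemma poisson_X_X0:
  "poisson (ham (X 1)) (ham X0) = (\<lambda>z. - ham (X 2) z)"
  "poisson (ham (X 2)) (ham X0) = ham (X 1)"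
  "poisson (ham (X 3)) (ham X0) = (\<lambda>_. 0)"
  using smooth_X_component[of 1] smooth_X_component[of 2] smooth_X_component[of 3]
  by (simp_all add: poisson_ham smooth_X0_component lie_bracket_X1_X0 lie_bracket_X2_X0
      lie_bracket_X3_X0 ham_uminus)

lemma poisson_hamiltonian_X0: "poisson hamiltonian (ham X0) = (\<lambda>_. 0)"
proof -
  have "poisson (ham X0) (ham (X 1)) = ham (X 2)" "poisson (ham X0) (ham (X 2)) = (\<lambda>z. - ham (X 1) z)"
    using poisson_X_X0 poisson_antisym[of "ham X0"] by simp_all
  then show ?thesis
    by (subst poisson_antisym) (simp add: poisson_hamiltonian_right fun_eq_iff del: X_nth One_nat_def)
qed

lemma poisson_X3_hamiltonian:
  "poisson (ham (X 3)) hamiltonian z = - (ham (X 1) z * ham (X 4) z + ham (X 2) z * ham (X 5) z)"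
  using smooth_X_component[of 1] smooth_X_component[of 2] smooth_X_component[of 3]
  by (simp add: poisson_hamiltonian_right poisson_ham lie_bracket_X3_X1 lie_bracket_X3_X2 ham_uminus)

lemma poisson_right_field:
  assumes "i \<in> {1..8}" "j \<in> {1..8}"
  shows "poisson (ham (right_field i)) (ham (right_field j)) = ham (lie_bracket (right_field i) (right_field j))"
  using assms by (intro poisson_ham smooth_right_field_component)

lemma poisson_X0_right_field:
  assumes "j \<in> {1..8}"
  shows "poisson (ham X0) (ham (right_field j)) = ham (lie_bracket X0 (right_field j))"
  using assms by (intro poisson_ham smooth_right_field_component smooth_X0_component)

section \<open>Functional independence\<close>

text \<open>A subfamily of an independent family is independent: extend the coefficients of a relation by
  zero.\<close>

lemma functionally_independent_reindex:
  assumes indep: "functionally_independent fs"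
    and inj: "inj_on r {..<length gs}" and range: "r ` {..<length gs} \<subseteq> {..<length fs}"
    and nth: "\<And>k. k < length gs \<Longrightarrow> gs ! k = fs ! r k"
  shows "functionally_independent gs"
proof -
  obtain U where U: "open U" "closure U = UNIV"
    and ind: "\<And>z c k. z \<in> U \<Longrightarrow> (\<forall>v. (\<Sum>k<length fs. c k * frechet_derivative (fs ! k) (at z) v) = 0) \<Longrightarrow>
      k < length fs \<Longrightarrow> c k = 0"
    using indep unfolding functionally_independent_def by blast
  have "c k = 0"
    if z: "z \<in> U" and rel: "\<forall>v. (\<Sum>k<length gs. c k * frechet_derivative (gs ! k) (at z) v) = 0"
      and k: "k < length gs" for z c k
  proof -
    let ?M = "{..<length gs}"
    define d where "d i = (if i \<in> r ` ?M then c (the_inv_into ?M r i) else 0)" for i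
    have d: "d (r k) = c k" if "k < length gs" for k
      using that inj by (auto simp: d_def the_inv_into_f_f)
    have "(\<Sum>i<length fs. d i * frechet_derivative (fs ! i) (at z) v) =
        (\<Sum>i\<in>r ` ?M. d i * frechet_derivative (fs ! i) (at z) v)" for v
      using range by (intro sum.mono_neutral_right) (auto simp: d_def)
    also have "\<dots> v = (\<Sum>k<length gs. c k * frechet_derivative (gs ! k) (at z) v)" for v
      using inj by (simp add: sum.reindex d nth)
    finally have "d (r k) = 0"
      using rel z range k by (intro ind[of z d]) auto
    then show ?thesis using d k by simp
  qed
  then show ?thesis
    using U unfolding functionally_independent_def by blast
qed

definition integrals :: "(8 cotangent \<Rightarrow> real) list" where
  "integrals = hamiltonian # map (\<lambda>j. ham (right_field j)) [1..<9] @ [ham X0]"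

lemma length_integrals: "length integrals = 10"
  by (simp add: integrals_def)

lemma integrals_nth:
  "integrals ! 0 = hamiltonian" "j \<in> {1..8} \<Longrightarrow> integrals ! j = ham (right_field j)"
  "integrals ! 9 = ham X0"
  by (auto simp: integrals_def nth_append nth_Cons')

lemma set_integrals: "set integrals = {hamiltonian, ham X0} \<union> (\<lambda>j. ham (right_field j)) ` {1..8}"
  by (auto simp: integrals_def)

lemma smooth_integrals: "f \<in> set integrals \<Longrightarrow> smooth f"
  by (auto simp: set_integrals)

text \<open>The integrals turn out to be independent wherever this function does not vanish. Its second
  factor is minus the bracket of \<open>h 3\<close> with the Hamiltonian, its first factor minus the bracket
  of \<open>h 1\<close> with \<open>h 0\<close>.\<close>

definition regular_factor :: "8 cotangent \<Rightarrow> real" where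
  "regular_factor z = ham (X 2) z * (ham (X 1) z * ham (X 4) z + ham (X 2) z * ham (X 5) z)"

text \<open>A relation between the differentials is applied to three kinds of vectors. The
  Hamiltonian vector of \<open>h 3\<close> annihilates all the \<open>g j\<close> and \<open>h 0\<close>, so it isolates the
  coefficient of the Hamiltonian. That of \<open>h 1\<close> then isolates the coefficient of \<open>h 0\<close>.
  Vertical vectors turn what is left into a relation between the values of the right-invariant
  frame at one point.\<close>

lemma integrals_independent_at:
  assumes reg: "regular_factor z \<noteq> 0"
    and rel: "\<And>v. (\<Sum>k<10. c k * frechet_derivative (integrals ! k) (at z) v) = 0"
    and k: "k < 10"
  shows "c k = 0"
proof -
  have expand: "(\<Sum>k<10. f k) = f 0 + (\<Sum>j=1..8. f j) + f 9" for f :: "nat \<Rightarrow> real"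
    by (simp add: numeral_eq_Suc)
  have rel': "c 0 * frechet_derivative hamiltonian (at z) v
      + (\<Sum>j=1..8. c j * frechet_derivative (ham (right_field j)) (at z) v)
      + c 9 * frechet_derivative (ham X0) (at z) v = 0" for v
    using rel[of v] unfolding expand by (simp add: integrals_nth)
  have br: "c 0 * poisson f hamiltonian z
      + (\<Sum>j=1..8. c j * poisson f (ham (right_field j)) z)
      + c 9 * poisson f (ham X0) z = 0" for f
    using rel'[of "ham_vector f z"] by (simp add: poisson_eq_derivative smooth_imp_differentiable)
  have c0: "c 0 = 0"
    using br[of "ham (X 3)"] reg
    by (simp add: poisson_X3_hamiltonian poisson_X_right_field poisson_X_X0 regular_factor_def
        del: X_nth One_nat_def)
  have c9: "c 9 = 0"
    using br[of "ham (X 1)"] reg c0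
    by (simp add: poisson_X_right_field poisson_X_X0 regular_factor_def del: X_nth One_nat_def)
  obtain x p where z: "z = (x, p)" by fastforce
  have vertical: "frechet_derivative (ham (right_field j)) (at z) (0, axis i 1) = right_field j x $ i"
    if j: "j \<in> {1..8}" for i j
  proof -
    obtain D where D: "(right_field j has_derivative D) (at x)"
      using has_derivative_vec_frechet[of "right_field j"] smooth_right_field_component[OF j]
      by (meson smooth_imp_differentiable)
    show ?thesis
      unfolding z frechet_derivative_eqI[OF has_derivative_ham[OF D]]
      using linear_0[OF has_derivative_linear[OF D]] by (simp add: inner_axis')
  qed
  have cj: "c j = 0" if "j \<in> {1..8}" for j
    using rel'[of "(0, axis _ 1)"] that
    by (intro right_field_frame[of c x]) (simp_all add: c0 c9 vertical)
  have "k = 0 \<or> k \<in> {1..8} \<or> k = 9" using k by auto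
  then show ?thesis using c0 cj c9 by blast
qed

text \<open>Through every point there is a line in the fibre on which the function is a monic cubic
  polynomial, so it has at most three zeros there.\<close>

lemma regular_factor_dense: "closure {z. regular_factor z \<noteq> 0} = UNIV"
proof -
  have "\<exists>w\<in>{z. regular_factor z \<noteq> 0}. dist w (x, p) < e" if "e > 0" for x p e
  proof -
    \<comment> \<open>This direction changes \<open>h 2\<close> and \<open>h 5\<close> at unit speed and keeps \<open>h 1\<close> and \<open>h 4\<close> fixed.\<close>
    define q :: "real^8" where "q = (((x$1)\<^sup>2 + (x$2)\<^sup>2) / 2) *\<^sub>R Dx 1 + Dx 2 + Dx 5"
    have ham_line: "ham V (x, p + t *\<^sub>R q) = ham V (x, p) + t * (q \<bullet> V x)" for V t
      by (simp add: ham_def inner_add_left)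
    have q: "q \<bullet> X1 x = 0" "q \<bullet> X2 x = 1" "q \<bullet> X4 x = 0" "q \<bullet> X5 x = 1"
      by (simp_all add: q_def inner_add_left inner_axis' frame_eqs)
    let ?h = "\<lambda>i. ham (X i) (x, p)"
    define P where "P = [:?h 2, 1:] * [:?h 1 * ?h 4 + ?h 2 * ?h 5, ?h 2 + ?h 5, 1:]"
    have poly: "regular_factor (x, p + t *\<^sub>R q) = poly P t" for t
      by (simp add: P_def regular_factor_def ham_line q algebra_simps)
    have "P \<noteq> 0"
      by (simp add: P_def del: mult_pCons_left mult_pCons_right)
    then have "finite {t. poly P t = 0}"
      by (rule poly_roots_finite)
    moreover have "0 < e / (norm q + 1)"
      using that by (intro divide_pos_pos add_nonneg_pos) simp_all
    then have "infinite {0<..<e / (norm q + 1)}"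
      by (rule infinite_Ioo)
    ultimately have "\<not> {0<..<e / (norm q + 1)} \<subseteq> {t. poly P t = 0}"
      using finite_subset by blast
    then obtain t where "t \<in> {0<..<e / (norm q + 1)}" "poly P t \<noteq> 0"
      by blast
    then have t: "0 < t" "t < e / (norm q + 1)" "poly P t \<noteq> 0"
      by simp_all
    have "dist (x, p + t *\<^sub>R q) (x, p) = t * norm q"
      using t by (simp add: dist_Pair_Pair dist_norm)
    also have "\<dots> \<le> t * (norm q + 1)"
      using t by simp
    also have "\<dots> < e"
      using t(2) by (simp add: pos_less_divide_eq add_nonneg_pos)
    finally show ?thesis
      using t(3) poly[of t] by (intro bexI[of _ "(x, p + t *\<^sub>R q)"]) simp_all
  qed
  then show ?thesis
    by (auto simp: closure_approachable)
qed

lemma functionally_independent_integrals: "functionally_independent integrals"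
proof -
  have "smooth regular_factor"
    unfolding regular_factor_def[abs_def] by (intro smooth_mult smooth_add smooth_ham_X) simp_all
  then have "continuous_on UNIV regular_factor"
    using C_k.simps(1) unfolding smooth_def by blast
  then have "open {z. regular_factor z \<noteq> 0}"
    by (simp add: open_Collect_neq)
  then show ?thesis
    unfolding functionally_independent_def length_integrals
    using regular_factor_dense integrals_independent_at by blast
qed

section \<open>The algebras of integrals\<close>

lemma poisson_right_field_table:
  "poisson (ham (right_field 1)) (ham (right_field 2)) = ham (right_field 3)"
  "poisson (ham (right_field 1)) (ham (right_field 3)) = ham (right_field 4)"
  "poisson (ham (right_field 2)) (ham (right_field 3)) = ham (right_field 5)"
  "poisson (ham (right_field 1)) (ham (right_field 4)) = ham (right_field 6)"
  "poisson (ham (right_field 1)) (ham (right_field 5)) = ham (right_field 7)"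
  "poisson (ham (right_field 2)) (ham (right_field 4)) = ham (right_field 7)"
  "poisson (ham (right_field 2)) (ham (right_field 5)) = ham (right_field 8)"
  by (simp_all add: poisson_right_field lie_bracket_right_field_1_2[simplified]
      lie_bracket_right_field_vertical[simplified])

lemma poisson_right_field_zero:
  assumes "i \<in> {1..8}" "j \<in> {1..8}" "i < j"
    and "(i, j) \<notin> {(1,2), (1,3), (2,3), (1,4), (1,5), (2,4), (2,5)}"
  shows "poisson (ham (right_field i)) (ham (right_field j)) = (\<lambda>_. 0)"
  by (simp only: poisson_right_field[OF assms(1,2)] lie_bracket_right_field_zero[OF assms] ham_zero)

lemma poisson_X0_right_field_table:
  "poisson (ham X0) (ham (right_field 1)) = ham (right_field 2)"
  "poisson (ham X0) (ham (right_field 2)) = (\<lambda>z. - ham (right_field 1) z)"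
  "poisson (ham X0) (ham (right_field 3)) = (\<lambda>_. 0)"
  "poisson (ham X0) (ham (right_field 4)) = ham (right_field 5)"
  "poisson (ham X0) (ham (right_field 5)) = (\<lambda>z. - ham (right_field 4) z)"
  "poisson (ham X0) (ham (right_field 6)) = (\<lambda>z. 2 * ham (right_field 7) z)"
  "poisson (ham X0) (ham (right_field 7)) = (\<lambda>z. ham (right_field 8) z - ham (right_field 6) z)"
  "poisson (ham X0) (ham (right_field 8)) = (\<lambda>z. - 2 * ham (right_field 7) z)"
  by (simp_all add: poisson_X0_right_field lie_bracket_X0_right_field_1[simplified]
      lie_bracket_X0_right_field_2[simplified] lie_bracket_X0_right_field_vertical
      ham_uminus ham_diff ham_scaleR del: scaleR_minus_left)

lemma right_field_in_span: "j \<in> {1..8} \<Longrightarrow> ham (right_field j) \<in> fun_span integrals"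
  by (intro fun_span_base) (auto simp: set_integrals)

lemma poisson_X0_right_field_in_span:
  assumes "j \<in> {1..8}"
  shows "poisson (ham X0) (ham (right_field j)) \<in> fun_span integrals"
proof -
  have diff: "(\<lambda>z. f z - g z) \<in> fun_span integrals"
    if "f \<in> fun_span integrals" "g \<in> fun_span integrals" for f g
    using fun_span_add[OF that(1) fun_span_uminus[OF that(2)]] by simp
  have "\<forall>j\<in>{1..8}. poisson (ham X0) (ham (right_field j)) \<in> fun_span integrals"
    unfolding all_index_8 poisson_X0_right_field_table
    by (intro conjI fun_span_zero fun_span_uminus fun_span_scale diff right_field_in_span) simp_all
  then show ?thesis using assms by blast
qed

lemma poisson_right_field_in_span:
  assumes "i \<in> {1..8}" "j \<in> {1..8}"
  shows "poisson (ham (right_field i)) (ham (right_field j)) \<in> fun_span integrals"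
proof -
  have less: "poisson (ham (right_field i)) (ham (right_field j)) \<in> fun_span integrals"
    if ij: "i \<in> {1..8}" "j \<in> {1..8}" "i < j" for i j
  proof (cases "(i, j) \<in> {(1,2), (1,3), (2,3), (1,4), (1,5), (2,4), (2,5)}")
    case True
    then show ?thesis
      by (elim insertE emptyE; clarsimp simp: poisson_right_field_table[simplified])
        (auto intro: right_field_in_span)
  next
    case False
    then show ?thesis
      using poisson_right_field_zero[OF ij] by (simp add: fun_span_zero)
  qed
  consider "i < j" | "j < i" | "i = j" by linarith
  then show ?thesis
  proof cases
    case 1
    then show ?thesis by (rule less[OF assms])
  next
    case 2
    then show ?thesis
      by (subst poisson_antisym) (intro fun_span_uminus less assms)
  qed (simp add: poisson_self fun_span_zero)
qed

lemma is_integral_integrals: "f \<in> set integrals \<Longrightarrow> is_integral hamiltonian f"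
  using poisson_hamiltonian_X0 poisson_hamiltonian_right_field
  by (auto simp: is_integral_def set_integrals poisson_self)

text \<open>The span is closed because the brackets of the \<open>g j\<close> among themselves and with \<open>h 0\<close>
  are again combinations of the \<open>g j\<close>, while the Hamiltonian commutes with everything.\<close>

lemma poisson_closed_integrals: "poisson_closed (fun_span integrals)"
proof (rule poisson_closedI[OF smooth_integrals])
  have left: "poisson hamiltonian f = (\<lambda>_. 0)" if "f \<in> set integrals" for f
    using is_integral_integrals[OF that] by (simp add: is_integral_def)
  have right: "poisson f hamiltonian = (\<lambda>_. 0)" if "f \<in> set integrals" for f
    using left[OF that] by (subst poisson_antisym) simp
  fix f g
  assume f: "f \<in> set integrals" and g: "g \<in> set integrals"
  have "poisson (ham (right_field j)) (ham X0) \<in> fun_span integrals" if "j \<in> {1..8}" for j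
    by (subst poisson_antisym) (intro fun_span_uminus poisson_X0_right_field_in_span that)
  with f g left[OF g] right[OF f] show "poisson f g \<in> fun_span integrals"
    unfolding set_integrals
    by (elim UnE insertE emptyE imageE)
      (auto simp: fun_span_zero poisson_self intro: poisson_X0_right_field_in_span poisson_right_field_in_span)
qed

definition abelian_integrals :: "(8 cotangent \<Rightarrow> real) list" where
  "abelian_integrals = hamiltonian # map (\<lambda>j. ham (right_field j)) [3..<9]"

lemma set_abelian_integrals:
  "set abelian_integrals = insert hamiltonian ((\<lambda>j. ham (right_field j)) ` {3..8})"
proof -
  have "{3..<9} = {3..8::nat}" by auto
  then show ?thesis
    by (simp only: abelian_integrals_def list.set set_map set_upt)
qed

lemma abelian_integrals_subset: "f \<in> set abelian_integrals \<Longrightarrow> f \<in> set integrals"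
  by (auto simp: set_abelian_integrals set_integrals)

text \<open>The fields \<open>right_field j\<close> with \<open>j \<ge> 3\<close> have constant coefficients and therefore
  commute.\<close>

lemma poisson_abelian_integrals: "poisson_abelian (fun_span abelian_integrals)"
proof (rule poisson_abelianI)
  show "smooth f" if "f \<in> set abelian_integrals" for f
    using that by (intro smooth_integrals abelian_integrals_subset)
  have left: "poisson hamiltonian f = (\<lambda>_. 0)" if "f \<in> set abelian_integrals" for f
    using is_integral_integrals[OF abelian_integrals_subset[OF that]] by (simp add: is_integral_def)
  have right: "poisson f hamiltonian = (\<lambda>_. 0)" if "f \<in> set abelian_integrals" for f
    using left[OF that] by (subst poisson_antisym) simp
  have "poisson (ham (right_field i)) (ham (right_field j)) = (\<lambda>_. 0)" if "i \<in> {3..8}" "j \<in> {3..8}" for i j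
    using that by (subst poisson_right_field) (simp_all add: right_field_const lie_bracket_const)
  then show "poisson f g = (\<lambda>_. 0)" if "f \<in> set abelian_integrals" "g \<in> set abelian_integrals" for f g
    using that left[OF that(2)] right[OF that(1)] unfolding set_abelian_integrals
    by (elim insertE imageE) simp_all
qed

lemma functionally_independent_abelian_integrals: "functionally_independent abelian_integrals"
proof (rule functionally_independent_reindex[OF functionally_independent_integrals,
      where r = "\<lambda>k. if k = 0 then 0 else k + 2"])
  show "abelian_integrals ! k = integrals ! (if k = 0 then 0 else k + 2)"
    if "k < length abelian_integrals" for k
  proof (cases k)
    case 0
    then show ?thesis by (simp add: abelian_integrals_def integrals_nth)
  next
    case (Suc m)
    then have "m < 6"
      using that by (simp add: abelian_integrals_def)
    then show ?thesis
      using Suc integrals_nth(2)[of "m + 3"] nth_map_upt[of m 9 3 "\<lambda>j. ham (right_field j)"]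
      by (simp add: abelian_integrals_def eval_nat_numeral del: upt_rec_numeral)
  qed
qed (auto simp: inj_on_def length_integrals abelian_integrals_def)

theorem theorem5:
  fixes G :: "(real ^ 8) monoid"
    and Y :: "nat \<Rightarrow> 8 vfield"
    and h g :: "nat \<Rightarrow> 8 cotangent \<Rightarrow> real"
    and H :: "8 cotangent \<Rightarrow> real"
    and I_gens A_gens :: "(8 cotangent \<Rightarrow> real) list"
  assumes G: "lie_group_on G" "\<one>\<^bsub>G\<^esub> = 0"
    and X_left: "\<forall>i\<in>{1..8}. left_invariant G (X i)"
    and Y_right: "\<forall>j\<in>{1..8}. right_invariant G (Y j)"
    and Y_Id: "\<forall>j\<in>{1..8}. Y j 0 = - X j 0"
    and h: "h = (\<lambda>i. ham (X i))"
    and g: "g = (\<lambda>j. ham (Y j))"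
    and H: "H = (\<lambda>z. ((h 1 z)\<^sup>2 + (h 2 z)\<^sup>2) / 2)"
    and I_gens: "I_gens = [H, g 1, g 2, g 3, g 4, g 5, g 6, g 7, g 8, h 0]"
    and A_gens: "A_gens = [H, g 3, g 4, g 5, g 6, g 7, g 8]"
  shows
    "(\<forall>f\<in>fun_span I_gens. is_integral H f) \<and>
     poisson_closed (fun_span I_gens) \<and>
     functionally_independent I_gens \<and>
     poisson (h 0) (g 4) = g 5 \<and>
     poisson (h 0) (g 5) = (\<lambda>z. - g 4 z) \<and>
     poisson (h 0) (g 6) = (\<lambda>z. 2 * g 7 z) \<and>
     poisson (h 0) (g 7) = (\<lambda>z. g 8 z - g 6 z) \<and>
     poisson (h 0) (g 8) = (\<lambda>z. - 2 * g 7 z) \<and>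
     poisson (h 0) (g 1) = g 2 \<and>
     poisson (h 0) (g 2) = (\<lambda>z. - g 1 z) \<and>
     poisson (h 0) (g 3) = (\<lambda>_. 0) \<and>
     poisson (g 1) (g 2) = g 3 \<and>
     poisson (g 1) (g 3) = g 4 \<and>
     poisson (g 2) (g 3) = g 5 \<and>
     poisson (g 1) (g 4) = g 6 \<and>
     poisson (g 1) (g 5) = g 7 \<and>
     poisson (g 2) (g 4) = g 7 \<and>
     poisson (g 2) (g 5) = g 8 \<and>
     (\<forall>i\<in>{1..8}. \<forall>j\<in>{1..8}. i < j \<longrightarrow>
        (i, j) \<notin> {(1,2), (1,3), (2,3), (1,4), (1,5), (2,4), (2,5)} \<longrightarrow>
        poisson (g i) (g j) = (\<lambda>_. 0)) \<and>
     poisson H (h 0) = (\<lambda>_. 0) \<and>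
     (\<forall>j\<in>{1..8}. poisson H (g j) = (\<lambda>_. 0)) \<and>
     (\<forall>f\<in>fun_span A_gens. is_integral H f) \<and>
     poisson_abelian (fun_span A_gens) \<and>
     functionally_independent A_gens"
proof -
  have Y_eq: "Y j = right_field j" if "j \<in> {1..8}" for j
    using that Y_right Y_Id by (intro right_invariant_eq_right_field[OF G X_left that]) blast+
  have g_eq: "g j = ham (right_field j)" if "j \<in> {1..8}" for j
    by (simp only: g Y_eq[OF that])
  have g_nth: "g 1 = ham (right_field 1)" "g 2 = ham (right_field 2)" "g 3 = ham (right_field 3)"
    "g 4 = ham (right_field 4)" "g 5 = ham (right_field 5)" "g 6 = ham (right_field 6)"
    "g 7 = ham (right_field 7)" "g 8 = ham (right_field 8)"
    by (simp_all add: g_eq)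
  have h0: "h 0 = ham X0"
    by (simp add: h)
  have H_eq: "H = hamiltonian"
    by (simp only: H h hamiltonian_def[abs_def])
  have upt: "[1..<9] = [1, 2, 3, 4, 5, 6, 7, 8::nat]" "[3..<9] = [3, 4, 5, 6, 7, 8::nat]"
    by (simp_all add: upt_rec)
  have I_eq: "I_gens = integrals"
    unfolding I_gens integrals_def upt H_eq h0 g_nth by simp
  have A_eq: "A_gens = abelian_integrals"
    unfolding A_gens abelian_integrals_def upt H_eq g_nth by simp
  have zero: "\<forall>i\<in>{1..8}. \<forall>j\<in>{1..8}. i < j \<longrightarrow>
      (i, j) \<notin> {(1,2), (1,3), (2,3), (1,4), (1,5), (2,4), (2,5)} \<longrightarrow>
      poisson (g i) (g j) = (\<lambda>_. 0)"
  proof (intro ballI impI)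
    fix i j :: nat
    assume i: "i \<in> {1..8}" and j: "j \<in> {1..8}" and "i < j"
      "(i, j) \<notin> {(1,2), (1,3), (2,3), (1,4), (1,5), (2,4), (2,5)}"
    then show "poisson (g i) (g j) = (\<lambda>_. 0)"
      unfolding g_eq[OF i] g_eq[OF j] by (rule poisson_right_field_zero)
  qed
  have inv: "\<forall>j\<in>{1..8}. poisson H (g j) = (\<lambda>_. 0)"
    by (intro ballI) (simp only: H_eq g_eq poisson_hamiltonian_right_field)
  have I: "\<forall>f\<in>fun_span integrals. is_integral hamiltonian f"
    using is_integral_fun_span[OF is_integral_integrals] by blast
  have A: "\<forall>f\<in>fun_span abelian_integrals. is_integral hamiltonian f"
    using is_integral_fun_span[OF is_integral_integrals[OF abelian_integrals_subset]] by blast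
  show ?thesis
    unfolding I_eq A_eq
    by (intro conjI zero inv I[folded H_eq] A[folded H_eq]; simp only: H_eq h0 g_nth
        poisson_closed_integrals functionally_independent_integrals poisson_X0_right_field_table
        poisson_right_field_table poisson_hamiltonian_X0 poisson_abelian_integrals
        functionally_independent_abelian_integrals)
qed

end
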